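(* Let $R$ be a unital ring (not necessarily commutative) and $\mathcal{A}$ a unital $R$-algebra. (Derivation case.) Let $D$ be an $R$-derivation of $\mathcal{A}$ and let $p(t)\in R[t]$ be a monic polynomial such that $p(D)=0$. Then there exists an $R$-algebra $\mathcal{B}$ containing $\mathcal{A}$ as an $R$-subalgebra such that: 1) $\mathcal{B}$ is finitely generated both as a left $\mathcal{A}$-module and as a right $\mathcal{A}$-module; 2) there exists $u\in\mathcal{B}$ such that $p(u)=0$ and $D=\operatorname{ad}_u|_{\mathcal{A}}$, i.e. $D(a)=ua-au$ for all $a\in\mathcal{A}$. (Automorphism case.) Let $\phi$ be an $R$-algebra automorphism of $\mathcal{A}$ and let $p(t)\in R[t]$ be a monic polynomial such that $p(\phi)=0$ and $p(0)$ is a unit of $R$. Then there exists an $R$-algebra $\mathcal{B}$ containing $\mathcal{A}$ as an $R$-subalgebra such that: 1) $\mathcal{B}$ is finitely generated both as a left $\mathcal{A}$-module and as a right $\mathcal{A}$-module; 2) there exists a unit $u\in\mathcal{B}$ such that $p(u)=0$ and $\phi=\operatorname{Ad}_u|_{\mathcal{A}}$, i.e. $\phi(a)=uau^{-1}$ for all $a\in\mathcal{A}$.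
   Context: Rings and algebras are associative. A unital $R$-algebra is a unital ring $\mathcal{A}$ with a left $R$-module structure satisfying $r(ab)=(ra)b$; equivalently, a unital ring with a unital ring homomorphism $R\to\mathcal{A}$, $r\mapsto r1_{\mathcal{A}}$ (its image need not be central). $\mathcal{B}$ is a unital $R$-algebra in this sense and shares its identity element with the subalgebra $\mathcal{A}$. $R$-linear means left $R$-linear. An $R$-derivation of $\mathcal{A}$ is an $R$-linear map $D:\mathcal{A}\to\mathcal{A}$ with $D(ab)=D(a)b+aD(b)$; an $R$-algebra automorphism is an $R$-linear ring automorphism. $R[t]$ is the polynomial ring in which $t$ commutes with $R$. For $p(t)=\sum_i\alpha_it^i\in R[t]$ and an $R$-linear endomorphism $\eta$ of $\mathcal{A}$, $p(\eta)$ is the map $a\mapsto\sum_i\alpha_i\eta^i(a)$; for $u\in\mathcal{B}$, $p(u)=\sum_i\alpha_iu^i$. *)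

theory Defs
  imports "HOL-Algebra.Algebra"
begin

text \<open>
  Unital algebras over a unital, not necessarily commutative, ring (the library's locales
  \<^locale>\<open>module\<close> and \<^locale>\<open>algebra\<close> require a commutative base). The axioms are those of a
  unital left module together with \<open>r(ab) = (ra)b\<close>; nothing forces \<open>R 1\<close> to be central.
  The locale \<^locale>\<open>ring\<close> has an identity element and admits the zero ring.
\<close>

locale unital_algebra = R?: ring R + A?: ring A
  for R :: "('r, 'm) ring_scheme" (structure) and A :: "('r, 'a, 'n) module_scheme" (structure) +
  assumes smult_closed [simp, intro]:
      "\<lbrakk> r \<in> carrier R; a \<in> carrier A \<rbrakk> \<Longrightarrow> r \<odot>\<^bsub>A\<^esub> a \<in> carrier A"
    and smult_l_distr:
      "\<lbrakk> r \<in> carrier R; s \<in> carrier R; a \<in> carrier A \<rbrakk> \<Longrightarrow>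
        (r \<oplus>\<^bsub>R\<^esub> s) \<odot>\<^bsub>A\<^esub> a = r \<odot>\<^bsub>A\<^esub> a \<oplus>\<^bsub>A\<^esub> s \<odot>\<^bsub>A\<^esub> a"
    and smult_r_distr:
      "\<lbrakk> r \<in> carrier R; a \<in> carrier A; b \<in> carrier A \<rbrakk> \<Longrightarrow>
        r \<odot>\<^bsub>A\<^esub> (a \<oplus>\<^bsub>A\<^esub> b) = r \<odot>\<^bsub>A\<^esub> a \<oplus>\<^bsub>A\<^esub> r \<odot>\<^bsub>A\<^esub> b"
    and smult_assoc1:
      "\<lbrakk> r \<in> carrier R; s \<in> carrier R; a \<in> carrier A \<rbrakk> \<Longrightarrow>
        (r \<otimes>\<^bsub>R\<^esub> s) \<odot>\<^bsub>A\<^esub> a = r \<odot>\<^bsub>A\<^esub> (s \<odot>\<^bsub>A\<^esub> a)"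
    and smult_one: "a \<in> carrier A \<Longrightarrow> \<one>\<^bsub>R\<^esub> \<odot>\<^bsub>A\<^esub> a = a"
    and smult_assoc2:
      "\<lbrakk> r \<in> carrier R; a \<in> carrier A; b \<in> carrier A \<rbrakk> \<Longrightarrow>
        r \<odot>\<^bsub>A\<^esub> (a \<otimes>\<^bsub>A\<^esub> b) = (r \<odot>\<^bsub>A\<^esub> a) \<otimes>\<^bsub>A\<^esub> b"

definition linear_map ::
    "('r, 'm) ring_scheme \<Rightarrow> ('r, 'a, 'n) module_scheme \<Rightarrow> ('r, 'b, 'k) module_scheme \<Rightarrow> ('a \<Rightarrow> 'b) \<Rightarrow> bool"
  where "linear_map R A B f \<longleftrightarrow>
    f \<in> carrier A \<rightarrow> carrier B \<and>
    (\<forall>a\<in>carrier A. \<forall>b\<in>carrier A. f (a \<oplus>\<^bsub>A\<^esub> b) = f a \<oplus>\<^bsub>B\<^esub> f b) \<and>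
    (\<forall>r\<in>carrier R. \<forall>a\<in>carrier A. f (r \<odot>\<^bsub>A\<^esub> a) = r \<odot>\<^bsub>B\<^esub> f a)"

definition derivation ::
    "('r, 'm) ring_scheme \<Rightarrow> ('r, 'a, 'n) module_scheme \<Rightarrow> ('a \<Rightarrow> 'a) \<Rightarrow> bool"
  where "derivation R A D \<longleftrightarrow>
    linear_map R A A D \<and>
    (\<forall>a\<in>carrier A. \<forall>b\<in>carrier A. D (a \<otimes>\<^bsub>A\<^esub> b) = D a \<otimes>\<^bsub>A\<^esub> b \<oplus>\<^bsub>A\<^esub> a \<otimes>\<^bsub>A\<^esub> D b)"

definition algebra_automorphism ::
    "('r, 'm) ring_scheme \<Rightarrow> ('r, 'a, 'n) module_scheme \<Rightarrow> ('a \<Rightarrow> 'a) \<Rightarrow> bool"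
  where "algebra_automorphism R A \<phi> \<longleftrightarrow> linear_map R A A \<phi> \<and> \<phi> \<in> ring_iso A A"

text \<open>
  \<^term>\<open>ring_hom A B\<close> consists of unital homomorphisms, so that under an embedding \<open>A\<close> and \<open>B\<close>
  share their identity element. Since the elements of an extension \<open>B\<close> need a type of their own,
  "\<open>B\<close> contains \<open>A\<close>" is expressed by an embedding. An existential claim about \<open>B\<close> must moreover name
  that type: \<open>'a \<Rightarrow> 'a\<close> has room for algebras of endomorphisms of \<open>A\<close>, and naming it only
  strengthens the claim.
\<close>

definition algebra_embedding ::
    "('r, 'm) ring_scheme \<Rightarrow> ('r, 'a, 'n) module_scheme \<Rightarrow> ('r, 'b, 'k) module_scheme \<Rightarrow> ('a \<Rightarrow> 'b) \<Rightarrow> bool"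
  where "algebra_embedding R A B \<iota> \<longleftrightarrow>
    linear_map R A B \<iota> \<and> \<iota> \<in> ring_hom A B \<and> inj_on \<iota> (carrier A)"

text \<open>
  Given a ring homomorphism \<open>\<iota>\<close> from \<open>A\<close> to \<open>B\<close>, the ring \<open>B\<close> is a left and a right
  \<open>A\<close>-module by multiplication with the elements \<open>\<iota> a\<close>.
\<close>

definition fin_gen_left ::
    "('a, 'm) ring_scheme \<Rightarrow> ('b, 'n) ring_scheme \<Rightarrow> ('a \<Rightarrow> 'b) \<Rightarrow> bool"
  where "fin_gen_left A B \<iota> \<longleftrightarrow>
    (\<exists>S. finite S \<and> S \<subseteq> carrier B \<and>
      (\<forall>b\<in>carrier B. \<exists>c\<in>S \<rightarrow> carrier A. b = (\<Oplus>\<^bsub>B\<^esub>s\<in>S. \<iota> (c s) \<otimes>\<^bsub>B\<^esub> s)))"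

definition fin_gen_right ::
    "('a, 'm) ring_scheme \<Rightarrow> ('b, 'n) ring_scheme \<Rightarrow> ('a \<Rightarrow> 'b) \<Rightarrow> bool"
  where "fin_gen_right A B \<iota> \<longleftrightarrow>
    (\<exists>S. finite S \<and> S \<subseteq> carrier B \<and>
      (\<forall>b\<in>carrier B. \<exists>c\<in>S \<rightarrow> carrier A. b = (\<Oplus>\<^bsub>B\<^esub>s\<in>S. s \<otimes>\<^bsub>B\<^esub> \<iota> (c s))))"

definition monic_poly :: "('r, 'm) ring_scheme \<Rightarrow> (nat \<Rightarrow> 'r) \<Rightarrow> bool"
  where "monic_poly R p \<longleftrightarrow>
    p \<in> carrier (UP R) \<and> coeff (UP R) p (deg R p) = \<one>\<^bsub>R\<^esub>"

text \<open>
  Evaluation at an element and at an endomorphism of an algebra. The coefficients stand on the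
  left, as they need not commute with anything.
\<close>

definition poly_at_elem ::
    "('r, 'm) ring_scheme \<Rightarrow> ('r, 'b, 'n) module_scheme \<Rightarrow> (nat \<Rightarrow> 'r) \<Rightarrow> 'b \<Rightarrow> 'b"
  where "poly_at_elem R B p u =
    (\<Oplus>\<^bsub>B\<^esub>i\<in>{..deg R p}. coeff (UP R) p i \<odot>\<^bsub>B\<^esub> (u [^]\<^bsub>B\<^esub> i))"

definition poly_at_map ::
    "('r, 'm) ring_scheme \<Rightarrow> ('r, 'a, 'n) module_scheme \<Rightarrow> (nat \<Rightarrow> 'r) \<Rightarrow> ('a \<Rightarrow> 'a) \<Rightarrow> 'a \<Rightarrow> 'a"
  where "poly_at_map R A p \<eta> a =
    (\<Oplus>\<^bsub>A\<^esub>i\<in>{..deg R p}. coeff (UP R) p i \<odot>\<^bsub>A\<^esub> (\<eta> ^^ i) a)"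

end

theory Submission
  imports Defs
begin

text \<open>
  Inside the ring of additive endomorphisms of \<open>A\<close>, which is an \<open>R\<close>-algebra by scaling values on
  the left, the algebra \<open>A\<close> embeds by left multiplications \<open>L\<^sub>a\<close>. A derivation \<open>D\<close> and an
  automorphism \<open>\<phi>\<close> are themselves elements of this ring, and the rules for products read
  \<open>D L\<^sub>a = L\<^sub>a D + L\<^bsub>D a\<^esub>\<close> and \<open>\<phi> L\<^sub>a = L\<^bsub>\<phi> a\<^esub> \<phi>\<close>. So \<open>u = D\<close>, respectively \<open>u = \<phi>\<close>, induces the
  given map on \<open>A\<close>, and \<open>p(u) = 0\<close> is the hypothesis \<open>p(D) = 0\<close>, respectively \<open>p(\<phi>) = 0\<close>. What has
  to be shown is that the subring \<open>B\<close> generated by \<open>A\<close> and \<open>u\<close> is small enough.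

  Both cases are instances of one relation, \<open>u a = \<tau>(a) u + \<delta>(a)\<close> with \<open>\<tau>\<close> mapping \<open>A\<close> onto \<open>A\<close>:
  take \<open>\<tau> = id\<close>, \<open>\<delta> = D\<close> or \<open>\<tau> = \<phi>\<close>, \<open>\<delta> = 0\<close>. Let \<open>n\<close> be the degree of \<open>p\<close>. Since \<open>p\<close> is monic,
  \<open>u\<^sup>n\<close> is a combination of lower powers with coefficients from \<open>R\<close> on the left; these commute with
  \<open>u\<close>, because \<open>D\<close> and \<open>\<phi>\<close> are \<open>R\<close>-linear. The relation moves \<open>u\<close> to the right past \<open>A\<close>, so the
  sums of terms \<open>a u\<^sup>i\<close> with \<open>i < n\<close> form a ring, which is \<open>B\<close> and is finitely generated as a left
  \<open>A\<close>-module. Surjectivity of \<open>\<tau>\<close> allows reading the relation backwards, as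
  \<open>\<tau>(a) u = u a - \<delta>(a)\<close>; moving \<open>u\<close> to the left in this way writes the elements of \<open>B\<close> as sums of
  terms \<open>u\<^sup>i a\<close> with \<open>i < n\<close>.

  In the automorphism case the inverse of \<open>u\<close> must lie in \<open>B\<close>, and it does as a polynomial in \<open>u\<close>:
  write \<open>p(t) = q(t) t + p(0)\<close>; then \<open>- p(0)\<^sup>-\<^sup>1 q(u)\<close> is inverse to \<open>u\<close>.
\<close>

section \<open>Additive spans\<close>

text \<open>
  The module spans are treated as additive submonoids: the generating sets used below are closed under
  negation, and statements about sums reduce to statements about single generators without
  any bookkeeping of indices.
\<close>

inductive_set additive_span :: "('b, 'n) ring_scheme \<Rightarrow> 'b set \<Rightarrow> 'b set"
  for E (structure) and S where
    gen: "x \<in> S \<Longrightarrow> x \<in> additive_span E S"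
  | zero: "\<zero> \<in> additive_span E S"
  | add: "\<lbrakk> x \<in> additive_span E S; y \<in> additive_span E S \<rbrakk> \<Longrightarrow> x \<oplus> y \<in> additive_span E S"

lemma (in abelian_group) additive_span_closed:
  assumes "S \<subseteq> carrier G" shows "additive_span G S \<subseteq> carrier G"
proof
  fix x assume "x \<in> additive_span G S"
  then show "x \<in> carrier G" using assms by induction auto
qed

lemma (in abelian_group) additive_span_image:
  assumes S: "S \<subseteq> carrier G"
    and h0: "h \<zero> = \<zero>"
    and hadd: "\<And>x y. \<lbrakk> x \<in> carrier G; y \<in> carrier G \<rbrakk> \<Longrightarrow> h (x \<oplus> y) = h x \<oplus> h y"
    and gen: "\<And>x. x \<in> S \<Longrightarrow> h x \<in> additive_span G Y"
    and x: "x \<in> additive_span G S"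
  shows "h x \<in> additive_span G Y"
  using x
proof induction
  case (add x y)
  then have "x \<in> carrier G" "y \<in> carrier G" using additive_span_closed[OF S] by auto
  then show ?case using add hadd additive_span.add by metis
qed (auto simp: h0 gen intro: additive_span.zero)

lemma (in abelian_group) additive_span_finsum:
  assumes S: "S \<subseteq> carrier G" and f: "\<And>i. i \<in> I \<Longrightarrow> f i \<in> additive_span G S"
  shows "(\<Oplus>i\<in>I. f i) \<in> additive_span G S"
  using f
proof (induction I rule: infinite_finite_induct)
  case (insert i I)
  have "f \<in> I \<rightarrow> carrier G" "f i \<in> carrier G"
    using insert.prems additive_span_closed[OF S] by auto
  then show ?case
    using insert by (simp add: additive_span.add)
qed (auto simp: finsum_infinite intro: additive_span.zero)

text \<open>
  Sums of terms \<open>m a s\<close> with repeated \<open>s\<close> can be collected into one term for each \<open>s\<close>.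
  For \<open>m a s = \<iota> a \<otimes> s\<close> and \<open>m a s = s \<otimes> \<iota> a\<close> this turns membership in an additive span into
  the linear combinations that finite generation asks for.
\<close>

lemma additive_span_combination:
  assumes "abelian_group A" and "abelian_group E" and S: "finite S"
    and m: "\<And>a s. \<lbrakk> a \<in> carrier A; s \<in> S \<rbrakk> \<Longrightarrow> m a s \<in> carrier E"
    and m_add: "\<And>a b s. \<lbrakk> a \<in> carrier A; b \<in> carrier A; s \<in> S \<rbrakk> \<Longrightarrow>
      m (a \<oplus>\<^bsub>A\<^esub> b) s = m a s \<oplus>\<^bsub>E\<^esub> m b s"
    and m_zero: "\<And>s. s \<in> S \<Longrightarrow> m \<zero>\<^bsub>A\<^esub> s = \<zero>\<^bsub>E\<^esub>"
    and x: "x \<in> additive_span E {m a s |a s. a \<in> carrier A \<and> s \<in> S}"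
  shows "\<exists>c\<in>S \<rightarrow> carrier A. x = (\<Oplus>\<^bsub>E\<^esub>s\<in>S. m (c s) s)"
proof -
  interpret A: abelian_group A by fact
  interpret E: abelian_group E by fact
  show ?thesis
    using x
  proof induction
    case (gen x)
    then obtain a s where as: "x = m a s" "a \<in> carrier A" "s \<in> S" by blast
    let ?c = "\<lambda>t. if s = t then a else \<zero>\<^bsub>A\<^esub>"
    have "(\<Oplus>\<^bsub>E\<^esub>t\<in>S. m (?c t) t) = (\<Oplus>\<^bsub>E\<^esub>t\<in>S. if s = t then m a t else \<zero>\<^bsub>E\<^esub>)"
      by (rule E.finsum_cong') (auto simp: m m_zero as)
    also have "\<dots> = m a s"
      by (rule E.finsum_singleton) (auto simp: S m as)
    finally show ?case
      using as by (intro bexI[of _ ?c]) auto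
  next
    case zero
    have "(\<Oplus>\<^bsub>E\<^esub>s\<in>S. m \<zero>\<^bsub>A\<^esub> s) = (\<Oplus>\<^bsub>E\<^esub>s\<in>S. \<zero>\<^bsub>E\<^esub>)"
      by (rule E.finsum_cong') (auto simp: m_zero)
    then show ?case
      by (intro bexI[of _ "\<lambda>_. \<zero>\<^bsub>A\<^esub>"]) auto
  next
    case (add x y)
    then obtain c d where cd: "c \<in> S \<rightarrow> carrier A" "x = (\<Oplus>\<^bsub>E\<^esub>s\<in>S. m (c s) s)"
      "d \<in> S \<rightarrow> carrier A" "y = (\<Oplus>\<^bsub>E\<^esub>s\<in>S. m (d s) s)"
      by blast
    have "(\<Oplus>\<^bsub>E\<^esub>s\<in>S. m (c s \<oplus>\<^bsub>A\<^esub> d s) s) = (\<Oplus>\<^bsub>E\<^esub>s\<in>S. m (c s) s \<oplus>\<^bsub>E\<^esub> m (d s) s)"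
      using cd(1,3) by (intro E.finsum_cong') (auto simp: m_add m Pi_iff)
    also have "\<dots> = x \<oplus>\<^bsub>E\<^esub> y"
      using cd m by (subst E.finsum_addf) (auto simp: Pi_iff)
    finally show ?case
      using cd by (intro bexI[of _ "\<lambda>s. c s \<oplus>\<^bsub>A\<^esub> d s"]) (auto simp: Pi_iff)
  qed
qed

section \<open>Subalgebras\<close>

lemma finsum_carrier_update:
  assumes "abelian_monoid E" and "abelian_monoid (E\<lparr>carrier := H\<rparr>)" and H: "H \<subseteq> carrier E"
    and f: "f \<in> I \<rightarrow> H"
  shows "finsum (E\<lparr>carrier := H\<rparr>) f I = finsum E f I"
proof -
  interpret E: abelian_monoid E by fact
  interpret H: abelian_monoid "E\<lparr>carrier := H\<rparr>" by fact
  show ?thesis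
    using f
  proof (induction I rule: infinite_finite_induct)
    case (infinite I)
    then show ?case using E.finsum_infinite H.finsum_infinite by simp
  next
    case (insert i I)
    then have "f \<in> I \<rightarrow> H" "f i \<in> H" by auto
    moreover from this have "f \<in> I \<rightarrow> carrier E" "f i \<in> carrier E" using H by auto
    ultimately show ?case
      using insert by simp
  qed simp
qed

lemma nat_pow_carrier_update: "x [^]\<^bsub>E\<lparr>carrier := H\<rparr>\<^esub> (k::nat) = x [^]\<^bsub>E\<^esub> k"
  by (induction k) (simp_all add: nat_pow_def)

context unital_algebra
begin

lemma smult_eq_mult_one:
  assumes "r \<in> carrier R" "a \<in> carrier A"
  shows "r \<odot>\<^bsub>A\<^esub> a = (r \<odot>\<^bsub>A\<^esub> \<one>\<^bsub>A\<^esub>) \<otimes>\<^bsub>A\<^esub> a"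
  using assms smult_assoc2[of r "\<one>\<^bsub>A\<^esub>" a] by simp

lemma subalgebra_carrier_update:
  assumes H: "subring H A" and s: "\<And>r a. \<lbrakk> r \<in> carrier R; a \<in> H \<rbrakk> \<Longrightarrow> r \<odot>\<^bsub>A\<^esub> a \<in> H"
  shows "unital_algebra R (A\<lparr>carrier := H\<rparr>)"
proof -
  have "H \<subseteq> carrier A" using H by (rule subringE(1))
  then have "a \<in> H \<Longrightarrow> a \<in> carrier A" for a by auto
  then show ?thesis
    using A.subring_is_ring[OF H] R.ring_axioms s
    by (intro unital_algebra.intro unital_algebra_axioms.intro)
      (auto simp: smult_l_distr smult_r_distr smult_assoc1 smult_assoc2 smult_one)
qed

lemma poly_at_elem_carrier_update:
  assumes H: "subring H A" and s: "\<And>r a. \<lbrakk> r \<in> carrier R; a \<in> H \<rbrakk> \<Longrightarrow> r \<odot>\<^bsub>A\<^esub> a \<in> H"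
    and p: "p \<in> carrier (UP R)" and u: "u \<in> H"
  shows "poly_at_elem R (A\<lparr>carrier := H\<rparr>) p u = poly_at_elem R A p u"
proof -
  interpret P: UP_ring R "UP R" by unfold_locales simp
  interpret H: unital_algebra R "A\<lparr>carrier := H\<rparr>" by (rule subalgebra_carrier_update[OF H s])
  have "u [^]\<^bsub>A\<^esub> (i::nat) \<in> H" for i
    using H.A.nat_pow_closed[of u i] u by (simp add: nat_pow_carrier_update)
  then show ?thesis
    unfolding poly_at_elem_def
    using p subringE(1)[OF H]
    by (simp add: nat_pow_carrier_update)
      (intro finsum_carrier_update A.abelian_monoid_axioms H.A.abelian_monoid_axioms,
        auto intro!: s P.coeff_closed)
qed

section \<open>Roots of polynomials whose constant term is a unit\<close>

text \<open>
  With \<open>p(t) = q(t) t + p(0)\<close> the equation \<open>p(u) = 0\<close> gives \<open>- p(0)\<^sup>-\<^sup>1 q(u) u = 1\<close>. This left inverse is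
  two-sided since \<open>u\<close> commutes with \<open>q(u)\<close> and with scalars.
\<close>

lemma root_in_Units:
  assumes p: "p \<in> carrier (UP R)" and unit: "up_ring.coeff (UP R) p 0 \<in> Units R"
    and u: "u \<in> carrier A" and root: "poly_at_elem R A p u = \<zero>\<^bsub>A\<^esub>"
    and u_smult: "\<And>r x. \<lbrakk> r \<in> carrier R; x \<in> carrier A \<rbrakk> \<Longrightarrow>
      u \<otimes>\<^bsub>A\<^esub> (r \<odot>\<^bsub>A\<^esub> x) = r \<odot>\<^bsub>A\<^esub> (u \<otimes>\<^bsub>A\<^esub> x)"
  shows "u \<in> Units A"
proof -
  interpret P: UP_ring R "UP R" by unfold_locales simp
  let ?\<alpha> = "up_ring.coeff (UP R) p" and ?n = "deg R p"
  have \<alpha> [simp, intro]: "?\<alpha> i \<in> carrier R" for i using p by (rule P.coeff_closed)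
  define r where "r = inv\<^bsub>R\<^esub> (?\<alpha> 0)"
  have r: "r \<in> carrier R" "r \<otimes>\<^bsub>R\<^esub> ?\<alpha> 0 = \<one>\<^bsub>R\<^esub>" using unit by (auto simp: r_def)
  \<comment> \<open>The last summand vanishes; the range up to the degree covers constant polynomials as well.\<close>
  define q where "q = (\<Oplus>\<^bsub>A\<^esub>i\<in>{..?n}. ?\<alpha> (Suc i) \<odot>\<^bsub>A\<^esub> (u [^]\<^bsub>A\<^esub> i))"
  have q: "q \<in> carrier A" unfolding q_def using u by auto
  have pow_u: "u \<otimes>\<^bsub>A\<^esub> (u [^]\<^bsub>A\<^esub> i) = u [^]\<^bsub>A\<^esub> Suc i" for i :: nat
    using u by (metis A.nat_pow_Suc2)
  have uq: "u \<otimes>\<^bsub>A\<^esub> q = (\<Oplus>\<^bsub>A\<^esub>i\<in>{..?n}. ?\<alpha> (Suc i) \<odot>\<^bsub>A\<^esub> (u [^]\<^bsub>A\<^esub> Suc i))"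
    unfolding q_def using u
    by (subst A.finsum_rdistr) (auto intro!: A.finsum_cong' simp: u_smult pow_u simp del: A.nat_pow_Suc)
  have qu: "q \<otimes>\<^bsub>A\<^esub> u = (\<Oplus>\<^bsub>A\<^esub>i\<in>{..?n}. ?\<alpha> (Suc i) \<odot>\<^bsub>A\<^esub> (u [^]\<^bsub>A\<^esub> Suc i))"
    unfolding q_def using u
    by (subst A.finsum_ldistr) (auto intro!: A.finsum_cong' simp: smult_assoc2)
  have "\<zero>\<^bsub>A\<^esub> = (\<Oplus>\<^bsub>A\<^esub>i\<in>{..Suc ?n}. ?\<alpha> i \<odot>\<^bsub>A\<^esub> (u [^]\<^bsub>A\<^esub> i))"
  proof -
    have "?\<alpha> (Suc ?n) = \<zero>\<^bsub>R\<^esub>" using p by (intro P.deg_aboveD) auto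
    moreover have "\<zero>\<^bsub>R\<^esub> \<odot>\<^bsub>A\<^esub> x = \<zero>\<^bsub>A\<^esub>" if "x \<in> carrier A" for x
    proof -
      have "\<zero>\<^bsub>R\<^esub> \<odot>\<^bsub>A\<^esub> x \<oplus>\<^bsub>A\<^esub> \<zero>\<^bsub>R\<^esub> \<odot>\<^bsub>A\<^esub> x = \<zero>\<^bsub>R\<^esub> \<odot>\<^bsub>A\<^esub> x"
        using that smult_l_distr[of "\<zero>\<^bsub>R\<^esub>" "\<zero>\<^bsub>R\<^esub>" x] by simp
      then show ?thesis using that by (metis A.add.r_cancel_one R.zero_closed smult_closed)
    qed
    ultimately show ?thesis
      using root u by (subst A.finsum_Suc) (auto simp: poly_at_elem_def simp del: A.nat_pow_Suc)
  qed
  also have "\<dots> = q \<otimes>\<^bsub>A\<^esub> u \<oplus>\<^bsub>A\<^esub> ?\<alpha> 0 \<odot>\<^bsub>A\<^esub> \<one>\<^bsub>A\<^esub>"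
    unfolding qu using u by (subst A.finsum_Suc2) auto
  finally have "?\<alpha> 0 \<odot>\<^bsub>A\<^esub> \<one>\<^bsub>A\<^esub> = \<ominus>\<^bsub>A\<^esub> (q \<otimes>\<^bsub>A\<^esub> u)"
    using q u by (metis A.minus_equality A.one_closed A.m_closed A.add.m_comm \<alpha> smult_closed)
  then have "r \<odot>\<^bsub>A\<^esub> (\<ominus>\<^bsub>A\<^esub> q \<otimes>\<^bsub>A\<^esub> u) = \<one>\<^bsub>A\<^esub>"
    using r q u smult_assoc1[of r "?\<alpha> 0" "\<one>\<^bsub>A\<^esub>"] by (simp add: A.l_minus smult_one)
  moreover have "u \<otimes>\<^bsub>A\<^esub> (r \<odot>\<^bsub>A\<^esub> (\<ominus>\<^bsub>A\<^esub> q)) = r \<odot>\<^bsub>A\<^esub> (\<ominus>\<^bsub>A\<^esub> q \<otimes>\<^bsub>A\<^esub> u)"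
    using u q r uq qu by (simp add: u_smult A.l_minus A.r_minus)
  ultimately have "(r \<odot>\<^bsub>A\<^esub> (\<ominus>\<^bsub>A\<^esub> q)) \<otimes>\<^bsub>A\<^esub> u = \<one>\<^bsub>A\<^esub>" "u \<otimes>\<^bsub>A\<^esub> (r \<odot>\<^bsub>A\<^esub> (\<ominus>\<^bsub>A\<^esub> q)) = \<one>\<^bsub>A\<^esub>"
    using r q u by (simp_all add: smult_assoc2)
  then show ?thesis
    unfolding Units_def using u q r by auto
qed

end

section \<open>The extension spanned by the powers of a skew-commuting root\<close>

text \<open>
  The hypothesis \<open>u_smult\<close> says that \<open>u\<close> commutes with the image of \<open>R\<close>. The relation \<open>skew\<close> is
  that of an Ore extension with twist \<open>\<tau>\<close>; it covers inner derivations (\<open>\<tau> = id\<close>) and inner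
  automorphisms (\<open>\<delta> = 0\<close>) at once.
\<close>

locale skew_root = A: unital_algebra R A + E: unital_algebra R E
  for R :: "('r, 'm) ring_scheme" and A :: "('r, 'a, 'n) module_scheme"
    and E :: "('r, 'b, 'k) module_scheme" +
  fixes \<iota> :: "'a \<Rightarrow> 'b" and u :: 'b and \<tau> \<delta> :: "'a \<Rightarrow> 'a" and p :: "nat \<Rightarrow> 'r"
  assumes embedding: "algebra_embedding R A E \<iota>"
    and u_closed [simp, intro]: "u \<in> carrier E"
    and u_smult: "\<lbrakk> r \<in> carrier R; x \<in> carrier E \<rbrakk> \<Longrightarrow> u \<otimes>\<^bsub>E\<^esub> (r \<odot>\<^bsub>E\<^esub> x) = r \<odot>\<^bsub>E\<^esub> (u \<otimes>\<^bsub>E\<^esub> x)"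
    and \<tau>_surj: "\<tau> ` carrier A = carrier A"
    and \<delta>_closed: "\<delta> \<in> carrier A \<rightarrow> carrier A"
    and skew: "a \<in> carrier A \<Longrightarrow> u \<otimes>\<^bsub>E\<^esub> \<iota> a = \<iota> (\<tau> a) \<otimes>\<^bsub>E\<^esub> u \<oplus>\<^bsub>E\<^esub> \<iota> (\<delta> a)"
    and monic: "monic_poly R p"
    and root: "poly_at_elem R E p u = \<zero>\<^bsub>E\<^esub>"
begin

abbreviation (input) n where "n \<equiv> deg R p"
abbreviation (input) \<alpha> where "\<alpha> \<equiv> up_ring.coeff (UP R) p"

definition left_generators where
  "left_generators = {\<iota> a \<otimes>\<^bsub>E\<^esub> s |a s. a \<in> carrier A \<and> s \<in> (\<lambda>i. u [^]\<^bsub>E\<^esub> i) ` {..<n}}"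

definition right_generators where
  "right_generators = {s \<otimes>\<^bsub>E\<^esub> \<iota> a |a s. a \<in> carrier A \<and> s \<in> (\<lambda>i. u [^]\<^bsub>E\<^esub> i) ` {..<n}}"

abbreviation "left_span \<equiv> additive_span E left_generators"
abbreviation "right_span \<equiv> additive_span E right_generators"

lemma coeff_closed [simp, intro]: "\<alpha> i \<in> carrier R"
proof -
  interpret P: UP_ring R "UP R" by unfold_locales simp
  show ?thesis using monic by (auto simp: monic_poly_def intro: P.coeff_closed)
qed

lemma \<iota>_closed [simp, intro]: "a \<in> carrier A \<Longrightarrow> \<iota> a \<in> carrier E"
  and \<iota>_add: "\<lbrakk> a \<in> carrier A; b \<in> carrier A \<rbrakk> \<Longrightarrow> \<iota> (a \<oplus>\<^bsub>A\<^esub> b) = \<iota> a \<oplus>\<^bsub>E\<^esub> \<iota> b"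
  and \<iota>_smult: "\<lbrakk> r \<in> carrier R; a \<in> carrier A \<rbrakk> \<Longrightarrow> \<iota> (r \<odot>\<^bsub>A\<^esub> a) = r \<odot>\<^bsub>E\<^esub> \<iota> a"
  and \<iota>_mult: "\<lbrakk> a \<in> carrier A; b \<in> carrier A \<rbrakk> \<Longrightarrow> \<iota> (a \<otimes>\<^bsub>A\<^esub> b) = \<iota> a \<otimes>\<^bsub>E\<^esub> \<iota> b"
  and \<iota>_one: "\<iota> \<one>\<^bsub>A\<^esub> = \<one>\<^bsub>E\<^esub>"
  using embedding by (auto simp: algebra_embedding_def linear_map_def ring_hom_def Pi_iff)

lemma \<iota>_zero: "\<iota> \<zero>\<^bsub>A\<^esub> = \<zero>\<^bsub>E\<^esub>"
  by (metis A.A.l_zero A.A.zero_closed E.A.add.r_cancel_one' \<iota>_add \<iota>_closed)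

lemma \<iota>_minus: "a \<in> carrier A \<Longrightarrow> \<iota> (\<ominus>\<^bsub>A\<^esub> a) = \<ominus>\<^bsub>E\<^esub> \<iota> a"
  by (metis A.A.l_neg A.A.a_inv_closed E.A.minus_equality \<iota>_add \<iota>_closed \<iota>_zero)

lemma \<tau>_closed: "a \<in> carrier A \<Longrightarrow> \<tau> a \<in> carrier A"
  using \<tau>_surj by auto

lemma \<delta>_closed' [simp]: "a \<in> carrier A \<Longrightarrow> \<delta> a \<in> carrier A"
  using \<delta>_closed by auto

lemma u_pow_smult:
  "\<lbrakk> r \<in> carrier R; x \<in> carrier E \<rbrakk> \<Longrightarrow>
    u [^]\<^bsub>E\<^esub> (i::nat) \<otimes>\<^bsub>E\<^esub> (r \<odot>\<^bsub>E\<^esub> x) = r \<odot>\<^bsub>E\<^esub> (u [^]\<^bsub>E\<^esub> i \<otimes>\<^bsub>E\<^esub> x)"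
  by (induction i arbitrary: x) (auto simp: u_smult E.A.m_assoc)

lemma left_generators_closed: "left_generators \<subseteq> carrier E"
  and right_generators_closed: "right_generators \<subseteq> carrier E"
  by (auto simp: left_generators_def right_generators_def)

lemma left_generatorsI:
  "\<lbrakk> a \<in> carrier A; i < n \<rbrakk> \<Longrightarrow> \<iota> a \<otimes>\<^bsub>E\<^esub> u [^]\<^bsub>E\<^esub> i \<in> left_generators"
  unfolding left_generators_def by blast

lemma right_generatorsI:
  "\<lbrakk> a \<in> carrier A; i < n \<rbrakk> \<Longrightarrow> u [^]\<^bsub>E\<^esub> i \<otimes>\<^bsub>E\<^esub> \<iota> a \<in> right_generators"
  unfolding right_generators_def by blast

lemma left_span_closed: "x \<in> left_span \<Longrightarrow> x \<in> carrier E"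
  using E.A.additive_span_closed[OF left_generators_closed] by auto

lemma u_pow_deg: "u [^]\<^bsub>E\<^esub> n = \<ominus>\<^bsub>E\<^esub> (\<Oplus>\<^bsub>E\<^esub>i\<in>{..<n}. \<alpha> i \<odot>\<^bsub>E\<^esub> (u [^]\<^bsub>E\<^esub> i))"
proof -
  have "poly_at_elem R E p u = \<alpha> n \<odot>\<^bsub>E\<^esub> (u [^]\<^bsub>E\<^esub> n) \<oplus>\<^bsub>E\<^esub> (\<Oplus>\<^bsub>E\<^esub>i\<in>{..<n}. \<alpha> i \<odot>\<^bsub>E\<^esub> (u [^]\<^bsub>E\<^esub> i))"
    unfolding poly_at_elem_def by (rule E.A.add.finprod_Suc3) auto
  then have "u [^]\<^bsub>E\<^esub> n \<oplus>\<^bsub>E\<^esub> (\<Oplus>\<^bsub>E\<^esub>i\<in>{..<n}. \<alpha> i \<odot>\<^bsub>E\<^esub> (u [^]\<^bsub>E\<^esub> i)) = \<zero>\<^bsub>E\<^esub>"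
    using root monic by (simp add: monic_poly_def E.smult_one)
  then show ?thesis
    by (subst E.A.minus_equality) auto
qed

text \<open>
  Here \<open>u\<^sup>n\<close> is reduced by \<open>p\<close>. On the left of it, \<open>a \<in> A\<close> absorbs the coefficients as \<open>a (\<alpha>\<^sub>i 1)\<close>.
\<close>

lemma left_span_u_pow_deg:
  assumes a: "a \<in> carrier A"
  shows "\<iota> a \<otimes>\<^bsub>E\<^esub> u [^]\<^bsub>E\<^esub> n \<in> left_span"
proof -
  let ?b = "\<lambda>i. \<ominus>\<^bsub>A\<^esub> a \<otimes>\<^bsub>A\<^esub> (\<alpha> i \<odot>\<^bsub>A\<^esub> \<one>\<^bsub>A\<^esub>)"
  have "\<iota> a \<otimes>\<^bsub>E\<^esub> u [^]\<^bsub>E\<^esub> n = \<iota> (\<ominus>\<^bsub>A\<^esub> a) \<otimes>\<^bsub>E\<^esub> (\<Oplus>\<^bsub>E\<^esub>i\<in>{..<n}. \<alpha> i \<odot>\<^bsub>E\<^esub> (u [^]\<^bsub>E\<^esub> i))"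
    using a by (subst u_pow_deg) (simp add: \<iota>_minus E.A.l_minus E.A.r_minus)
  also have "\<dots> = (\<Oplus>\<^bsub>E\<^esub>i\<in>{..<n}. \<iota> (?b i) \<otimes>\<^bsub>E\<^esub> u [^]\<^bsub>E\<^esub> i)"
  proof (subst E.A.finsum_rdistr, simp, use a in simp, force, rule E.A.finsum_cong')
    fix i assume "i \<in> {..<n}"
    show "\<iota> (\<ominus>\<^bsub>A\<^esub> a) \<otimes>\<^bsub>E\<^esub> (\<alpha> i \<odot>\<^bsub>E\<^esub> (u [^]\<^bsub>E\<^esub> i)) = \<iota> (?b i) \<otimes>\<^bsub>E\<^esub> u [^]\<^bsub>E\<^esub> i"
      using a E.smult_eq_mult_one[of "\<alpha> i" "u [^]\<^bsub>E\<^esub> i"]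
      by (simp add: \<iota>_mult \<iota>_smult \<iota>_one E.A.m_assoc)
  qed (use a in auto)
  also have "\<dots> \<in> left_span"
  proof (rule E.A.additive_span_finsum[OF left_generators_closed])
    fix i assume "i \<in> {..<n}"
    then show "\<iota> (?b i) \<otimes>\<^bsub>E\<^esub> u [^]\<^bsub>E\<^esub> i \<in> left_span"
      using a by (intro additive_span.gen left_generatorsI) auto
  qed
  finally show ?thesis .
qed

text \<open>
  With \<open>a\<close> on the right of \<open>u\<^sup>n\<close>, the coefficients stand on the wrong side of \<open>u\<^sup>i\<close>; they pass it
  because \<open>u\<close> commutes with scalars, and become \<open>\<alpha>\<^sub>i a\<close>.
\<close>

lemma right_span_u_pow_deg:
  assumes a: "a \<in> carrier A"
  shows "u [^]\<^bsub>E\<^esub> n \<otimes>\<^bsub>E\<^esub> \<iota> a \<in> right_span"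
proof -
  let ?b = "\<lambda>i. \<alpha> i \<odot>\<^bsub>A\<^esub> \<ominus>\<^bsub>A\<^esub> a"
  have "u [^]\<^bsub>E\<^esub> n \<otimes>\<^bsub>E\<^esub> \<iota> a = (\<Oplus>\<^bsub>E\<^esub>i\<in>{..<n}. \<alpha> i \<odot>\<^bsub>E\<^esub> (u [^]\<^bsub>E\<^esub> i)) \<otimes>\<^bsub>E\<^esub> \<iota> (\<ominus>\<^bsub>A\<^esub> a)"
    using a by (subst u_pow_deg) (simp add: \<iota>_minus E.A.l_minus E.A.r_minus)
  also have "\<dots> = (\<Oplus>\<^bsub>E\<^esub>i\<in>{..<n}. u [^]\<^bsub>E\<^esub> i \<otimes>\<^bsub>E\<^esub> \<iota> (?b i))"
    using a by (subst E.A.finsum_ldistr)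
      (auto intro!: E.A.finsum_cong' simp: \<iota>_smult u_pow_smult E.smult_assoc2)
  also have "\<dots> \<in> right_span"
  proof (rule E.A.additive_span_finsum[OF right_generators_closed])
    fix i assume "i \<in> {..<n}"
    then show "u [^]\<^bsub>E\<^esub> i \<otimes>\<^bsub>E\<^esub> \<iota> (?b i) \<in> right_span"
      using a by (intro additive_span.gen right_generatorsI) auto
  qed
  finally show ?thesis .
qed

lemma left_span_u_pow_le:
  assumes "a \<in> carrier A" "i \<le> n"
  shows "\<iota> a \<otimes>\<^bsub>E\<^esub> u [^]\<^bsub>E\<^esub> i \<in> left_span"
proof (cases "i = n")
  case True
  then show ?thesis using assms left_span_u_pow_deg by simp
next
  case False
  then have "i < n" using assms by simp
  then show ?thesis using assms by (intro additive_span.gen left_generatorsI)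
qed

lemma right_span_u_pow_le:
  assumes "a \<in> carrier A" "i \<le> n"
  shows "u [^]\<^bsub>E\<^esub> i \<otimes>\<^bsub>E\<^esub> \<iota> a \<in> right_span"
proof (cases "i = n")
  case True
  then show ?thesis using assms right_span_u_pow_deg by simp
next
  case False
  then have "i < n" using assms by simp
  then show ?thesis using assms by (intro additive_span.gen right_generatorsI)
qed

lemma left_span_mult_u:
  assumes "x \<in> left_span" shows "x \<otimes>\<^bsub>E\<^esub> u \<in> left_span"
proof (rule E.A.additive_span_image[OF left_generators_closed _ _ _ assms])
  fix x assume "x \<in> left_generators"
  then obtain a i where x: "x = \<iota> a \<otimes>\<^bsub>E\<^esub> u [^]\<^bsub>E\<^esub> i" "a \<in> carrier A" "i < n"
    by (auto simp: left_generators_def)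
  then have "x \<otimes>\<^bsub>E\<^esub> u = \<iota> a \<otimes>\<^bsub>E\<^esub> u [^]\<^bsub>E\<^esub> Suc i"
    by (simp add: E.A.m_assoc)
  with x show "x \<otimes>\<^bsub>E\<^esub> u \<in> left_span" using left_span_u_pow_le[of a "Suc i"] by simp
qed (auto simp: E.A.l_distr)

lemma u_mult_left_span:
  assumes "x \<in> left_span" shows "u \<otimes>\<^bsub>E\<^esub> x \<in> left_span"
proof (rule E.A.additive_span_image[OF left_generators_closed _ _ _ assms])
  fix x assume "x \<in> left_generators"
  then obtain a i where x: "x = \<iota> a \<otimes>\<^bsub>E\<^esub> u [^]\<^bsub>E\<^esub> i" "a \<in> carrier A" "i < n"
    by (auto simp: left_generators_def)
  then have "u \<otimes>\<^bsub>E\<^esub> x = (u \<otimes>\<^bsub>E\<^esub> \<iota> a) \<otimes>\<^bsub>E\<^esub> u [^]\<^bsub>E\<^esub> i"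
    by (simp add: E.A.m_assoc)
  also have "\<dots> = \<iota> (\<tau> a) \<otimes>\<^bsub>E\<^esub> (u \<otimes>\<^bsub>E\<^esub> u [^]\<^bsub>E\<^esub> i) \<oplus>\<^bsub>E\<^esub> \<iota> (\<delta> a) \<otimes>\<^bsub>E\<^esub> u [^]\<^bsub>E\<^esub> i"
    using x by (simp add: skew \<tau>_closed E.A.m_assoc E.A.l_distr)
  also have "u \<otimes>\<^bsub>E\<^esub> u [^]\<^bsub>E\<^esub> i = u [^]\<^bsub>E\<^esub> Suc i"
    by (metis E.A.nat_pow_Suc2 u_closed)
  finally show "u \<otimes>\<^bsub>E\<^esub> x \<in> left_span"
    using x left_span_u_pow_le[of "\<tau> a" "Suc i"] left_span_u_pow_le[of "\<delta> a" i]
    by (simp add: \<tau>_closed additive_span.add)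
qed (auto simp: E.A.r_distr)

lemma \<iota>_mult_left_span:
  assumes "a \<in> carrier A" "x \<in> left_span" shows "\<iota> a \<otimes>\<^bsub>E\<^esub> x \<in> left_span"
proof (rule E.A.additive_span_image[OF left_generators_closed _ _ _ assms(2)])
  fix x assume "x \<in> left_generators"
  then obtain b i where x: "x = \<iota> b \<otimes>\<^bsub>E\<^esub> u [^]\<^bsub>E\<^esub> i" "b \<in> carrier A" "i < n"
    by (auto simp: left_generators_def)
  then have "\<iota> a \<otimes>\<^bsub>E\<^esub> x = \<iota> (a \<otimes>\<^bsub>A\<^esub> b) \<otimes>\<^bsub>E\<^esub> u [^]\<^bsub>E\<^esub> i"
    using assms by (simp add: \<iota>_mult E.A.m_assoc)
  with x assms show "\<iota> a \<otimes>\<^bsub>E\<^esub> x \<in> left_span" using left_span_u_pow_le[of "a \<otimes>\<^bsub>A\<^esub> b" i] by simp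
qed (use assms in \<open>auto simp: E.A.r_distr\<close>)

text \<open>
  It is enough that multiplication by \<open>u\<close> and by elements of \<open>A\<close> on the left preserves the span, since
  a generator \<open>a u\<^sup>i\<close> acts on it by these multiplications in turn.
\<close>

lemma left_span_mult:
  assumes "x \<in> left_span" "y \<in> left_span" shows "x \<otimes>\<^bsub>E\<^esub> y \<in> left_span"
proof (rule E.A.additive_span_image[OF left_generators_closed _ _ _ assms(1)])
  have pow: "u [^]\<^bsub>E\<^esub> i \<otimes>\<^bsub>E\<^esub> y \<in> left_span" if "y \<in> left_span" for i :: nat and y
    using that
    by (induction i arbitrary: y) (auto simp: left_span_closed E.A.m_assoc u_mult_left_span)
  fix x assume "x \<in> left_generators"
  then obtain a i where x: "x = \<iota> a \<otimes>\<^bsub>E\<^esub> u [^]\<^bsub>E\<^esub> i" "a \<in> carrier A" "i < n"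
    by (auto simp: left_generators_def)
  then show "x \<otimes>\<^bsub>E\<^esub> y \<in> left_span"
    using assms(2) by (simp add: E.A.m_assoc left_span_closed pow \<iota>_mult_left_span)
qed (use assms(2) in \<open>auto simp: E.A.l_distr left_span_closed\<close>)

lemma \<iota>_in_left_span: "a \<in> carrier A \<Longrightarrow> \<iota> a \<in> left_span"
  using left_span_u_pow_le[of a 0] by simp

lemma one_in_left_span: "\<one>\<^bsub>E\<^esub> \<in> left_span"
  using \<iota>_in_left_span[of "\<one>\<^bsub>A\<^esub>"] by (simp add: \<iota>_one)

lemma u_in_left_span: "u \<in> left_span"
  using left_span_mult_u[OF one_in_left_span] by simp

lemma subring_left_span: "subring left_span E"
proof (rule E.A.subringI)
  fix x assume x: "x \<in> left_span"
  have "\<ominus>\<^bsub>E\<^esub> x = \<iota> (\<ominus>\<^bsub>A\<^esub> \<one>\<^bsub>A\<^esub>) \<otimes>\<^bsub>E\<^esub> x"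
    using left_span_closed[OF x] by (simp add: \<iota>_minus \<iota>_one E.A.l_minus)
  with x show "\<ominus>\<^bsub>E\<^esub> x \<in> left_span" using \<iota>_mult_left_span[of "\<ominus>\<^bsub>A\<^esub> \<one>\<^bsub>A\<^esub>" x] by simp
qed (auto simp: left_span_closed left_span_mult one_in_left_span intro: additive_span.add)

lemma smult_left_span:
  assumes "r \<in> carrier R" "x \<in> left_span" shows "r \<odot>\<^bsub>E\<^esub> x \<in> left_span"
proof -
  have "r \<odot>\<^bsub>E\<^esub> x = \<iota> (r \<odot>\<^bsub>A\<^esub> \<one>\<^bsub>A\<^esub>) \<otimes>\<^bsub>E\<^esub> x"
    using E.smult_eq_mult_one[of r x] assms left_span_closed by (simp add: \<iota>_smult \<iota>_one)
  with assms show ?thesis using \<iota>_mult_left_span[of "r \<odot>\<^bsub>A\<^esub> \<one>\<^bsub>A\<^esub>" x] by simp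
qed

text \<open>
  Surjectivity of \<open>\<tau>\<close> enters here: with \<open>a = \<tau>(b)\<close> the relation reads \<open>a u = u b - \<delta>(b)\<close>.
\<close>

lemma right_span_mult_u:
  assumes "x \<in> right_span" shows "x \<otimes>\<^bsub>E\<^esub> u \<in> right_span"
proof (rule E.A.additive_span_image[OF right_generators_closed _ _ _ assms])
  fix x assume "x \<in> right_generators"
  then obtain a i where x: "x = u [^]\<^bsub>E\<^esub> i \<otimes>\<^bsub>E\<^esub> \<iota> a" "a \<in> carrier A" "i < n"
    by (auto simp: right_generators_def)
  have "a \<in> \<tau> ` carrier A" using x(2) by (simp add: \<tau>_surj)
  then obtain b where b: "b \<in> carrier A" "\<tau> b = a" by blast
  have "\<iota> a \<otimes>\<^bsub>E\<^esub> u = u \<otimes>\<^bsub>E\<^esub> \<iota> b \<oplus>\<^bsub>E\<^esub> \<iota> (\<ominus>\<^bsub>A\<^esub> \<delta> b)"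
    using skew[OF b(1)] b x by (simp add: \<iota>_minus E.A.a_assoc E.A.r_neg)
  then have "x \<otimes>\<^bsub>E\<^esub> u = u [^]\<^bsub>E\<^esub> Suc i \<otimes>\<^bsub>E\<^esub> \<iota> b \<oplus>\<^bsub>E\<^esub> u [^]\<^bsub>E\<^esub> i \<otimes>\<^bsub>E\<^esub> \<iota> (\<ominus>\<^bsub>A\<^esub> \<delta> b)"
    using x b by (simp add: E.A.m_assoc E.A.r_distr)
  then show "x \<otimes>\<^bsub>E\<^esub> u \<in> right_span"
    using x b right_span_u_pow_le[of b "Suc i"] right_span_u_pow_le[of "\<ominus>\<^bsub>A\<^esub> \<delta> b" i]
    by (simp add: additive_span.add)
qed (auto simp: E.A.l_distr)

lemma left_span_subset_right_span:
  assumes "x \<in> left_span" shows "x \<in> right_span"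
proof (rule E.A.additive_span_image[OF left_generators_closed _ _ _ assms])
  have pow: "y \<otimes>\<^bsub>E\<^esub> u [^]\<^bsub>E\<^esub> i \<in> right_span" if "y \<in> right_span" for i :: nat and y
    using that E.A.additive_span_closed[OF right_generators_closed]
    by (induction i) (auto simp: E.A.m_assoc[symmetric] right_span_mult_u subset_iff)
  fix x assume "x \<in> left_generators"
  then obtain a i where x: "x = \<iota> a \<otimes>\<^bsub>E\<^esub> u [^]\<^bsub>E\<^esub> i" "a \<in> carrier A" "i < n"
    by (auto simp: left_generators_def)
  then show "x \<in> right_span"
    using pow right_span_u_pow_le[of a 0] by simp
qed auto

abbreviation "extension \<equiv> E\<lparr>carrier := left_span\<rparr>"

lemma extension_unital_algebra: "unital_algebra R extension"
  by (rule E.subalgebra_carrier_update[OF subring_left_span smult_left_span])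

lemma extension_embedding: "algebra_embedding R A extension \<iota>"
  using embedding
  by (auto simp: algebra_embedding_def linear_map_def ring_hom_def \<iota>_in_left_span)

lemma extension_root: "poly_at_elem R extension p u = \<zero>\<^bsub>extension\<^esub>"
  using monic root u_in_left_span
  by (simp add: E.poly_at_elem_carrier_update[OF subring_left_span smult_left_span] monic_poly_def)

lemma u_pow_in_left_span: "u [^]\<^bsub>E\<^esub> (i::nat) \<in> left_span"
  by (induction i) (auto simp: one_in_left_span left_span_mult_u)

lemma finsum_extension:
  assumes "f \<in> I \<rightarrow> left_span" shows "finsum extension f I = finsum E f I"
proof -
  interpret B: unital_algebra R extension by (rule extension_unital_algebra)
  show ?thesis
    using assms by (intro finsum_carrier_update E.A.abelian_monoid_axioms B.A.abelian_monoid_axioms)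
      (auto simp: left_span_closed)
qed

lemma extension_fin_gen_left: "fin_gen_left A extension \<iota>"
  unfolding fin_gen_left_def
proof (intro exI conjI ballI)
  let ?S = "(\<lambda>i. u [^]\<^bsub>E\<^esub> i) ` {..<n}"
  show "finite ?S" by simp
  show "?S \<subseteq> carrier extension" using u_pow_in_left_span by auto
  fix x assume "x \<in> carrier extension"
  then have "x \<in> additive_span E {\<iota> a \<otimes>\<^bsub>E\<^esub> s |a s. a \<in> carrier A \<and> s \<in> ?S}"
    by (simp add: left_generators_def)
  then have "\<exists>c\<in>?S \<rightarrow> carrier A. x = (\<Oplus>\<^bsub>E\<^esub>s\<in>?S. \<iota> (c s) \<otimes>\<^bsub>E\<^esub> s)"
    by (intro additive_span_combination A.A.abelian_group_axioms E.A.abelian_group_axioms)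
      (auto simp: \<iota>_add \<iota>_zero E.A.l_distr)
  then obtain c where c: "c \<in> ?S \<rightarrow> carrier A" "x = (\<Oplus>\<^bsub>E\<^esub>s\<in>?S. \<iota> (c s) \<otimes>\<^bsub>E\<^esub> s)" by blast
  have "(\<lambda>s. \<iota> (c s) \<otimes>\<^bsub>E\<^esub> s) \<in> ?S \<rightarrow> left_span"
    using c(1) by (auto intro!: left_span_mult \<iota>_in_left_span u_pow_in_left_span)
  with c show "\<exists>c\<in>?S \<rightarrow> carrier A. x = (\<Oplus>\<^bsub>extension\<^esub>s\<in>?S. \<iota> (c s) \<otimes>\<^bsub>extension\<^esub> s)"
    by (intro bexI[of _ c]) (simp_all add: finsum_extension)
qed

lemma extension_fin_gen_right: "fin_gen_right A extension \<iota>"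
  unfolding fin_gen_right_def
proof (intro exI conjI ballI)
  let ?S = "(\<lambda>i. u [^]\<^bsub>E\<^esub> i) ` {..<n}"
  show "finite ?S" by simp
  show "?S \<subseteq> carrier extension" using u_pow_in_left_span by auto
  fix x assume "x \<in> carrier extension"
  then have "x \<in> additive_span E {s \<otimes>\<^bsub>E\<^esub> \<iota> a |a s. a \<in> carrier A \<and> s \<in> ?S}"
    using left_span_subset_right_span[of x] by (simp add: right_generators_def)
  then have "\<exists>c\<in>?S \<rightarrow> carrier A. x = (\<Oplus>\<^bsub>E\<^esub>s\<in>?S. s \<otimes>\<^bsub>E\<^esub> \<iota> (c s))"
    by (intro additive_span_combination[where m = "\<lambda>a s. s \<otimes>\<^bsub>E\<^esub> \<iota> a"]
        A.A.abelian_group_axioms E.A.abelian_group_axioms)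
      (auto simp: \<iota>_add \<iota>_zero E.A.r_distr)
  then obtain c where c: "c \<in> ?S \<rightarrow> carrier A" "x = (\<Oplus>\<^bsub>E\<^esub>s\<in>?S. s \<otimes>\<^bsub>E\<^esub> \<iota> (c s))" by blast
  have "(\<lambda>s. s \<otimes>\<^bsub>E\<^esub> \<iota> (c s)) \<in> ?S \<rightarrow> left_span"
    using c(1) by (auto intro!: left_span_mult \<iota>_in_left_span u_pow_in_left_span)
  with c show "\<exists>c\<in>?S \<rightarrow> carrier A. x = (\<Oplus>\<^bsub>extension\<^esub>s\<in>?S. s \<otimes>\<^bsub>extension\<^esub> \<iota> (c s))"
    by (intro bexI[of _ c]) (simp_all add: finsum_extension)
qed

end

section \<open>The algebra of additive endomorphisms\<close>

text \<open>
  Functions are fixed outside the carrier of \<open>A\<close> by extensionality, so that equality of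
  endomorphisms is equality of values on the carrier. The maps are only required to be additive:
  left multiplication by \<open>a\<close> need not be \<open>R\<close>-linear when the image of \<open>R\<close> is not central.
\<close>

definition endomorphism_algebra :: "('r, 'a, 'n) module_scheme \<Rightarrow> ('r, 'a \<Rightarrow> 'a) module"
  where "endomorphism_algebra A =
    \<lparr> carrier = {f \<in> carrier A \<rightarrow>\<^sub>E carrier A.
        \<forall>a\<in>carrier A. \<forall>b\<in>carrier A. f (a \<oplus>\<^bsub>A\<^esub> b) = f a \<oplus>\<^bsub>A\<^esub> f b},
      monoid.mult = compose (carrier A),
      monoid.one = (\<lambda>x\<in>carrier A. x),
      ring.zero = (\<lambda>x\<in>carrier A. \<zero>\<^bsub>A\<^esub>),
      ring.add = (\<lambda>f g. \<lambda>x\<in>carrier A. f x \<oplus>\<^bsub>A\<^esub> g x),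
      module.smult = (\<lambda>r f. \<lambda>x\<in>carrier A. r \<odot>\<^bsub>A\<^esub> f x) \<rparr>"

context unital_algebra
begin

abbreviation (input) "End \<equiv> endomorphism_algebra A"

lemma endomorphism_app_closed [simp]:
  "\<lbrakk> f \<in> carrier End; a \<in> carrier A \<rbrakk> \<Longrightarrow> f a \<in> carrier A"
  by (auto simp: endomorphism_algebra_def)

lemma endomorphism_app_add:
  "\<lbrakk> f \<in> carrier End; a \<in> carrier A; b \<in> carrier A \<rbrakk> \<Longrightarrow> f (a \<oplus>\<^bsub>A\<^esub> b) = f a \<oplus>\<^bsub>A\<^esub> f b"
  by (auto simp: endomorphism_algebra_def)

lemma endomorphism_eqI:
  "\<lbrakk> f \<in> carrier End; g \<in> carrier End; \<And>a. a \<in> carrier A \<Longrightarrow> f a = g a \<rbrakk> \<Longrightarrow> f = g"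
  by (auto simp: endomorphism_algebra_def intro: PiE_ext)

lemma endomorphism_operations:
  "\<zero>\<^bsub>End\<^esub> = (\<lambda>x\<in>carrier A. \<zero>\<^bsub>A\<^esub>)"
  "\<one>\<^bsub>End\<^esub> = (\<lambda>x\<in>carrier A. x)"
  "f \<oplus>\<^bsub>End\<^esub> g = (\<lambda>x\<in>carrier A. f x \<oplus>\<^bsub>A\<^esub> g x)"
  "f \<otimes>\<^bsub>End\<^esub> g = (\<lambda>x\<in>carrier A. f (g x))"
  "r \<odot>\<^bsub>End\<^esub> f = (\<lambda>x\<in>carrier A. r \<odot>\<^bsub>A\<^esub> f x)"
  by (simp_all add: endomorphism_algebra_def compose_def)

lemma endomorphism_app [simp]:
  assumes "a \<in> carrier A"
  shows "\<zero>\<^bsub>End\<^esub> a = \<zero>\<^bsub>A\<^esub>" "\<one>\<^bsub>End\<^esub> a = a" "(f \<oplus>\<^bsub>End\<^esub> g) a = f a \<oplus>\<^bsub>A\<^esub> g a"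
    "(f \<otimes>\<^bsub>End\<^esub> g) a = f (g a)" "(r \<odot>\<^bsub>End\<^esub> f) a = r \<odot>\<^bsub>A\<^esub> f a"
  using assms by (simp_all add: endomorphism_operations)

lemma restrict_endomorphism:
  assumes "\<And>a. a \<in> carrier A \<Longrightarrow> h a \<in> carrier A"
    and "\<And>a b. \<lbrakk> a \<in> carrier A; b \<in> carrier A \<rbrakk> \<Longrightarrow> h (a \<oplus>\<^bsub>A\<^esub> b) = h a \<oplus>\<^bsub>A\<^esub> h b"
  shows "restrict h (carrier A) \<in> carrier End"
  using assms by (auto simp: endomorphism_algebra_def)

lemma endomorphism_closed [simp, intro]:
  "\<zero>\<^bsub>End\<^esub> \<in> carrier End" "\<one>\<^bsub>End\<^esub> \<in> carrier End"
  "\<lbrakk> f \<in> carrier End; g \<in> carrier End \<rbrakk> \<Longrightarrow> f \<oplus>\<^bsub>End\<^esub> g \<in> carrier End"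
  "\<lbrakk> f \<in> carrier End; g \<in> carrier End \<rbrakk> \<Longrightarrow> f \<otimes>\<^bsub>End\<^esub> g \<in> carrier End"
  "\<lbrakk> r \<in> carrier R; f \<in> carrier End \<rbrakk> \<Longrightarrow> r \<odot>\<^bsub>End\<^esub> f \<in> carrier End"
  unfolding endomorphism_operations
  by (rule restrict_endomorphism; simp add: endomorphism_app_add smult_r_distr A.a_ac)+

lemma endomorphism_ring: "ring End"
proof (rule ringI)
  show "abelian_group End"
  proof (rule abelian_groupI)
    fix f assume f: "f \<in> carrier End"
    let ?g = "\<lambda>x\<in>carrier A. \<ominus>\<^bsub>A\<^esub> f x"
    have g: "?g \<in> carrier End"
      using f by (intro restrict_endomorphism) (auto simp: endomorphism_app_add A.minus_add)
    then have "?g \<oplus>\<^bsub>End\<^esub> f = \<zero>\<^bsub>End\<^esub>"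
      using f by (intro endomorphism_eqI) (auto simp: A.l_neg)
    with g show "\<exists>g\<in>carrier End. g \<oplus>\<^bsub>End\<^esub> f = \<zero>\<^bsub>End\<^esub>" by blast
  qed (auto intro!: endomorphism_eqI simp: A.a_ac)
  show "monoid End"
    by (rule monoidI) (auto intro!: endomorphism_eqI)
qed (auto intro!: endomorphism_eqI simp: endomorphism_app_add)

lemma endomorphism_unital_algebra: "unital_algebra R End"
  by (intro unital_algebra.intro unital_algebra_axioms.intro endomorphism_ring R.ring_axioms)
    (auto intro!: endomorphism_eqI simp: smult_l_distr smult_r_distr smult_assoc1 smult_one)

lemma endomorphism_finsum_app:
  assumes "f \<in> I \<rightarrow> carrier End" "a \<in> carrier A"
  shows "finsum End f I a = (\<Oplus>\<^bsub>A\<^esub>i\<in>I. f i a)"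
proof -
  interpret E: ring End by (rule endomorphism_ring)
  show ?thesis
    using assms(1)
  proof (induction I rule: infinite_finite_induct)
    case (infinite I)
    then show ?case using assms(2) by (simp add: E.finsum_infinite A.finsum_infinite)
  next
    case (insert i I)
    then have "f \<in> I \<rightarrow> carrier End" "f i \<in> carrier End" by auto
    moreover from this have "(\<lambda>i. f i a) \<in> I \<rightarrow> carrier A" "f i a \<in> carrier A"
      using assms(2) by (auto simp: Pi_iff)
    ultimately show ?case
      using insert assms(2) by simp
  qed (use assms(2) in simp)
qed

definition left_mult :: "'a \<Rightarrow> 'a \<Rightarrow> 'a"
  where "left_mult a = (\<lambda>x\<in>carrier A. a \<otimes>\<^bsub>A\<^esub> x)"

lemma left_mult_app: "x \<in> carrier A \<Longrightarrow> left_mult a x = a \<otimes>\<^bsub>A\<^esub> x"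
  by (simp add: left_mult_def)

lemma left_mult_closed: "a \<in> carrier A \<Longrightarrow> left_mult a \<in> carrier End"
  unfolding left_mult_def by (rule restrict_endomorphism) (auto simp: A.r_distr)

text \<open>The element \<open>a\<close> is recovered from its left multiplication as the value at \<open>1\<close>.\<close>

lemma left_mult_embedding: "algebra_embedding R A End left_mult"
proof -
  have "a = b" if "a \<in> carrier A" "b \<in> carrier A" "left_mult a = left_mult b" for a b
    using that(1,2) fun_cong[OF that(3), of "\<one>\<^bsub>A\<^esub>"] by (simp add: left_mult_app)
  then show ?thesis
    unfolding algebra_embedding_def linear_map_def ring_hom_def inj_on_def
    by (auto intro!: endomorphism_eqI left_mult_closed
        simp: left_mult_app A.l_distr A.m_assoc smult_assoc2)
qed

lemma linear_restrict_endomorphism: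
  assumes "linear_map R A A T" shows "restrict T (carrier A) \<in> carrier End"
  using assms by (intro restrict_endomorphism) (auto simp: linear_map_def)

lemma restrict_nat_pow_app:
  assumes T: "linear_map R A A T" and a: "a \<in> carrier A"
  shows "(restrict T (carrier A) [^]\<^bsub>End\<^esub> (i::nat)) a = (T ^^ i) a"
  using a
proof (induction i arbitrary: a)
  case (Suc i)
  interpret E: ring End by (rule endomorphism_ring)
  have "T a \<in> carrier A" using T Suc.prems by (auto simp: linear_map_def)
  then show ?case using Suc by (simp add: funpow_swap1)
qed simp

lemma poly_at_restrict_eq_zero:
  assumes T: "linear_map R A A T" and p: "p \<in> carrier (UP R)"
    and root: "\<forall>a\<in>carrier A. poly_at_map R A p T a = \<zero>\<^bsub>A\<^esub>"
  shows "poly_at_elem R End p (restrict T (carrier A)) = \<zero>\<^bsub>End\<^esub>"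
proof -
  interpret P: UP_ring R "UP R" by unfold_locales simp
  interpret E: unital_algebra R End by (rule endomorphism_unital_algebra)
  let ?u = "restrict T (carrier A)" and ?\<alpha> = "up_ring.coeff (UP R) p"
  have cl: "(\<lambda>i. ?\<alpha> i \<odot>\<^bsub>End\<^esub> (?u [^]\<^bsub>End\<^esub> i)) \<in> {..deg R p} \<rightarrow> carrier End"
    using p linear_restrict_endomorphism[OF T]
    by (auto intro!: E.smult_closed E.A.nat_pow_closed P.coeff_closed)
  have cl': "(T ^^ i) a \<in> carrier A" if "a \<in> carrier A" for i a
    using T that by (induction i) (auto simp: linear_map_def)
  show ?thesis
  proof (rule endomorphism_eqI)
    fix a assume a: "a \<in> carrier A"
    have "poly_at_elem R End p ?u a = poly_at_map R A p T a"
      unfolding poly_at_elem_def poly_at_map_def endomorphism_finsum_app[OF cl a]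
      using a p by (intro A.finsum_cong')
        (auto simp: restrict_nat_pow_app[OF T] intro!: smult_closed cl' P.coeff_closed)
    then show "poly_at_elem R End p ?u a = \<zero>\<^bsub>End\<^esub> a" using root a by simp
  qed (use cl in \<open>auto simp: poly_at_elem_def\<close>)
qed

text \<open>
  The product rule for \<open>T\<close> is the relation \<open>T L\<^sub>a = L\<^bsub>\<tau> a\<^esub> T + L\<^bsub>\<delta> a\<^esub>\<close>, evaluated pointwise.
\<close>

lemma skew_root_endomorphism:
  assumes T: "linear_map R A A T"
    and \<tau>: "\<tau> ` carrier A = carrier A" and \<delta>: "\<delta> \<in> carrier A \<rightarrow> carrier A"
    and T_mult: "\<And>a b. \<lbrakk> a \<in> carrier A; b \<in> carrier A \<rbrakk> \<Longrightarrow>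
      T (a \<otimes>\<^bsub>A\<^esub> b) = \<tau> a \<otimes>\<^bsub>A\<^esub> T b \<oplus>\<^bsub>A\<^esub> \<delta> a \<otimes>\<^bsub>A\<^esub> b"
    and p: "monic_poly R p" and root: "\<forall>a\<in>carrier A. poly_at_map R A p T a = \<zero>\<^bsub>A\<^esub>"
  shows "skew_root R A End left_mult (restrict T (carrier A)) \<tau> \<delta> p"
proof (intro skew_root.intro skew_root_axioms.intro)
  let ?u = "restrict T (carrier A)"
  have u: "?u \<in> carrier End" by (rule linear_restrict_endomorphism[OF T])
  then show "?u \<in> carrier End" .
  have T_app: "T a \<in> carrier A" if "a \<in> carrier A" for a
    using T that by (auto simp: linear_map_def)
  have \<tau>_app: "\<tau> a \<in> carrier A" if "a \<in> carrier A" for a using \<tau> that by auto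
  show "?u \<otimes>\<^bsub>End\<^esub> (r \<odot>\<^bsub>End\<^esub> f) = r \<odot>\<^bsub>End\<^esub> (?u \<otimes>\<^bsub>End\<^esub> f)"
    if "r \<in> carrier R" "f \<in> carrier End" for r f
    using that u T by (intro endomorphism_eqI) (auto simp: linear_map_def)
  show "?u \<otimes>\<^bsub>End\<^esub> left_mult a = left_mult (\<tau> a) \<otimes>\<^bsub>End\<^esub> ?u \<oplus>\<^bsub>End\<^esub> left_mult (\<delta> a)"
    if a: "a \<in> carrier A" for a
    using a u \<delta> by (intro endomorphism_eqI)
      (auto intro!: endomorphism_closed left_mult_closed simp: \<tau>_app T_app left_mult_app T_mult Pi_iff)
  show "poly_at_elem R End p ?u = \<zero>\<^bsub>End\<^esub>"
    using poly_at_restrict_eq_zero[OF T _ root] p by (simp add: monic_poly_def)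
qed (fact unital_algebra_axioms endomorphism_unital_algebra left_mult_embedding \<tau> \<delta> p)+

end

section \<open>Realising derivations and automorphisms as inner ones\<close>

lemma (in ring) eval_zero_eq_coeff:
  assumes p: "p \<in> carrier (UP R)"
  shows "UnivPoly.eval R R id \<zero> p = up_ring.coeff (UP R) p 0"
proof -
  interpret P: UP_ring R "UP R" by unfold_locales simp
  have "UnivPoly.eval R R id \<zero> p = (\<Oplus>i\<in>{..deg R p}. if 0 = i then up_ring.coeff (UP R) p i else \<zero>)"
    using p unfolding UnivPoly.eval_def
    by (auto intro!: finsum_cong' simp: P.coeff_closed nat_pow_zero)
  also have "\<dots> = up_ring.coeff (UP R) p 0"
    using p by (intro finsum_singleton) (auto simp: P.coeff_closed)
  finally show ?thesis .
qed

theorem theorem1p9: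
  fixes R :: "('r, 'm) ring_scheme" and A :: "('r, 'a, 'n) module_scheme"
  assumes "ring R" and "unital_algebra R A"
  shows
    "(\<forall>D p. derivation R A D \<longrightarrow> monic_poly R p \<longrightarrow>
        (\<forall>a\<in>carrier A. poly_at_map R A p D a = \<zero>\<^bsub>A\<^esub>) \<longrightarrow>
        (\<exists>(B :: ('r, 'a \<Rightarrow> 'a) module) \<iota>.
          unital_algebra R B \<and> algebra_embedding R A B \<iota> \<and>
          fin_gen_left A B \<iota> \<and> fin_gen_right A B \<iota> \<and>
          (\<exists>u\<in>carrier B. poly_at_elem R B p u = \<zero>\<^bsub>B\<^esub> \<and>
            (\<forall>a\<in>carrier A. \<iota> (D a) = u \<otimes>\<^bsub>B\<^esub> \<iota> a \<ominus>\<^bsub>B\<^esub> \<iota> a \<otimes>\<^bsub>B\<^esub> u)))) \<and>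
     (\<forall>\<phi> p. algebra_automorphism R A \<phi> \<longrightarrow> monic_poly R p \<longrightarrow>
        (\<forall>a\<in>carrier A. poly_at_map R A p \<phi> a = \<zero>\<^bsub>A\<^esub>) \<longrightarrow>
        eval R R id \<zero>\<^bsub>R\<^esub> p \<in> Units R \<longrightarrow>
        (\<exists>(B :: ('r, 'a \<Rightarrow> 'a) module) \<iota>.
          unital_algebra R B \<and> algebra_embedding R A B \<iota> \<and>
          fin_gen_left A B \<iota> \<and> fin_gen_right A B \<iota> \<and>
          (\<exists>u\<in>Units B. poly_at_elem R B p u = \<zero>\<^bsub>B\<^esub> \<and>
            (\<forall>a\<in>carrier A. \<iota> (\<phi> a) = u \<otimes>\<^bsub>B\<^esub> \<iota> a \<otimes>\<^bsub>B\<^esub> inv\<^bsub>B\<^esub> u))))"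
proof (intro conjI allI impI)
  interpret A: unital_algebra R A by fact
  fix D p
  assume D: "derivation R A D" and p: "monic_poly R p"
    and root: "\<forall>a\<in>carrier A. poly_at_map R A p D a = \<zero>\<^bsub>A\<^esub>"
  have lin: "linear_map R A A D" using D by (simp add: derivation_def)
  have D_closed: "D \<in> carrier A \<rightarrow> carrier A" using lin by (simp add: linear_map_def)
  have D_mult: "D (a \<otimes>\<^bsub>A\<^esub> b) = id a \<otimes>\<^bsub>A\<^esub> D b \<oplus>\<^bsub>A\<^esub> D a \<otimes>\<^bsub>A\<^esub> b"
    if "a \<in> carrier A" "b \<in> carrier A" for a b
    using D D_closed that by (auto simp: derivation_def Pi_iff A.A.a_comm)
  interpret S: skew_root R A "endomorphism_algebra A" A.left_mult "restrict D (carrier A)" id D p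
    by (rule A.skew_root_endomorphism[OF lin _ D_closed D_mult p root]) simp
  interpret B: unital_algebra R S.extension by (rule S.extension_unital_algebra)
  let ?u = "restrict D (carrier A)"
  have "A.left_mult (D a) =
      ?u \<otimes>\<^bsub>S.extension\<^esub> A.left_mult a \<ominus>\<^bsub>S.extension\<^esub> A.left_mult a \<otimes>\<^bsub>S.extension\<^esub> ?u"
    if a: "a \<in> carrier A" for a
  proof -
    have cl: "?u \<in> carrier S.extension" "A.left_mult a \<in> carrier S.extension"
      "A.left_mult (D a) \<in> carrier S.extension"
      using a D_closed by (auto simp: S.\<iota>_in_left_span S.u_in_left_span)
    have "?u \<otimes>\<^bsub>S.extension\<^esub> A.left_mult a =
        A.left_mult a \<otimes>\<^bsub>S.extension\<^esub> ?u \<oplus>\<^bsub>S.extension\<^esub> A.left_mult (D a)"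
      using S.skew[OF a] by simp
    then show ?thesis
      using cl by (metis B.A.add.m_comm B.A.add.m_closed B.A.m_closed B.A.minus_eq B.A.r_neg1
          B.A.a_inv_closed)
  qed
  then show "\<exists>(B :: ('r, 'a \<Rightarrow> 'a) module) \<iota>.
      unital_algebra R B \<and> algebra_embedding R A B \<iota> \<and>
      fin_gen_left A B \<iota> \<and> fin_gen_right A B \<iota> \<and>
      (\<exists>u\<in>carrier B. poly_at_elem R B p u = \<zero>\<^bsub>B\<^esub> \<and>
        (\<forall>a\<in>carrier A. \<iota> (D a) = u \<otimes>\<^bsub>B\<^esub> \<iota> a \<ominus>\<^bsub>B\<^esub> \<iota> a \<otimes>\<^bsub>B\<^esub> u))"
    using S.extension_unital_algebra S.extension_embedding S.extension_fin_gen_left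
      S.extension_fin_gen_right S.extension_root S.u_in_left_span
    by (intro exI[of _ S.extension] exI[of _ A.left_mult] conjI bexI[of _ ?u] ballI) auto
next
  interpret A: unital_algebra R A by fact
  fix \<phi> p
  assume \<phi>: "algebra_automorphism R A \<phi>" and p: "monic_poly R p"
    and root: "\<forall>a\<in>carrier A. poly_at_map R A p \<phi> a = \<zero>\<^bsub>A\<^esub>"
    and unit: "eval R R id \<zero>\<^bsub>R\<^esub> p \<in> Units R"
  have lin: "linear_map R A A \<phi>" and iso: "\<phi> \<in> ring_iso A A"
    using \<phi> by (simp_all add: algebra_automorphism_def)
  have \<phi>_closed: "\<phi> a \<in> carrier A" if "a \<in> carrier A" for a
    using lin that by (auto simp: linear_map_def)
  have surj: "\<phi> ` carrier A = carrier A"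
    using iso by (auto simp: ring_iso_def bij_betw_def)
  have \<phi>_mult: "\<phi> (a \<otimes>\<^bsub>A\<^esub> b) = \<phi> a \<otimes>\<^bsub>A\<^esub> \<phi> b \<oplus>\<^bsub>A\<^esub> (\<lambda>_. \<zero>\<^bsub>A\<^esub>) a \<otimes>\<^bsub>A\<^esub> b"
    if "a \<in> carrier A" "b \<in> carrier A" for a b
    using iso that by (simp add: ring_iso_def ring_hom_def \<phi>_closed)
  interpret S: skew_root R A "endomorphism_algebra A" A.left_mult "restrict \<phi> (carrier A)" \<phi>
    "\<lambda>_. \<zero>\<^bsub>A\<^esub>" p
    by (rule A.skew_root_endomorphism[OF lin surj _ \<phi>_mult p root]) auto
  interpret B: unital_algebra R S.extension by (rule S.extension_unital_algebra)
  let ?u = "restrict \<phi> (carrier A)"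
  have p': "p \<in> carrier (UP R)" using p by (simp add: monic_poly_def)
  have u: "?u \<in> Units S.extension"
  proof (rule B.root_in_Units[OF p'])
    show "up_ring.coeff (UP R) p 0 \<in> Units R" using unit by (simp add: A.R.eval_zero_eq_coeff[OF p'])
  qed (use S.extension_root S.u_in_left_span S.left_span_closed in \<open>auto simp: S.u_smult\<close>)
  have "A.left_mult (\<phi> a) = ?u \<otimes>\<^bsub>S.extension\<^esub> A.left_mult a \<otimes>\<^bsub>S.extension\<^esub> inv\<^bsub>S.extension\<^esub> ?u"
    if a: "a \<in> carrier A" for a
  proof -
    have cl: "A.left_mult (\<phi> a) \<in> carrier S.extension"
      using a by (simp add: S.\<iota>_in_left_span \<phi>_closed)
    have "?u \<otimes>\<^bsub>S.extension\<^esub> A.left_mult a = A.left_mult (\<phi> a) \<otimes>\<^bsub>S.extension\<^esub> ?u"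
      using S.skew[OF a] a by (simp add: S.\<iota>_zero \<phi>_closed)
    then show ?thesis
      using cl u by (metis B.A.Units_closed B.A.Units_inv_closed B.A.Units_r_inv B.A.m_assoc B.A.r_one)
  qed
  then show "\<exists>(B :: ('r, 'a \<Rightarrow> 'a) module) \<iota>.
      unital_algebra R B \<and> algebra_embedding R A B \<iota> \<and>
      fin_gen_left A B \<iota> \<and> fin_gen_right A B \<iota> \<and>
      (\<exists>u\<in>Units B. poly_at_elem R B p u = \<zero>\<^bsub>B\<^esub> \<and>
        (\<forall>a\<in>carrier A. \<iota> (\<phi> a) = u \<otimes>\<^bsub>B\<^esub> \<iota> a \<otimes>\<^bsub>B\<^esub> inv\<^bsub>B\<^esub> u))"
    using S.extension_unital_algebra S.extension_embedding S.extension_fin_gen_left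
      S.extension_fin_gen_right S.extension_root u
    by (intro exI[of _ S.extension] exI[of _ A.left_mult] conjI bexI[of _ ?u] ballI) auto
qed

end
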